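(* For each integer $n\ge 0$, $$\overline{SOME}(16n)\equiv 2^2\,\overline{SOME}(4n)\pmod{2^7},$$ $$\overline{SOME}(32n)\equiv 2^2\,\overline{SOME}(8n)\pmod{2^9}.$$
   Context: An overpartition of a nonnegative integer $n$ is a partition of $n$ in which the first occurrence of each distinct part may be overlined (or not). For $n\ge 0$, $\overline{SOME}(n)$ denotes the sum, over all overpartitions $\lambda$ of $n$, of (the sum of the odd parts of $\lambda$) minus (the sum of the even parts of $\lambda$), where parts are counted with multiplicity and an overlined part counts with its numerical size; thus $\overline{SOME}(0)=0$. *)

theory Defs
  imports "HOL-Library.Multiset" "HOL-Number_Theory.Cong"
begin

text \<open>
  An overpartition of \<open>n\<close> is encoded as a pair \<open>(P, S)\<close>: \<open>P\<close> is the multiset of (positive) parts,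
  with overlines removed, and \<open>S\<close> is the set of those part sizes whose first occurrence is overlined.
\<close>

definition overpartitions :: "nat \<Rightarrow> (nat multiset \<times> nat set) set" where
  "overpartitions n = {(P, S). 0 \<notin># P \<and> sum_mset P = n \<and> S \<subseteq> set_mset P}"

definition SOME_over :: "nat \<Rightarrow> int" where
  "SOME_over n =
     (\<Sum>(P, S)\<in>overpartitions n.
        int (\<Sum>k\<in>#filter_mset odd P. k) - int (\<Sum>k\<in>#filter_mset even P. k))"

text \<open>The sum above is over a finite set, so it does not take the default value 0.\<close>

lemma size_le_sum_mset:
  assumes "0 \<notin># P"
  shows "size P \<le> sum_mset P"
  using assms by (induction P) auto

lemma finite_overpartitions: "finite (overpartitions n)"
proof (rule finite_subset)
  let ?M = "mset ` {xs. set xs \<subseteq> {..n} \<and> length xs \<le> n}"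
  show "overpartitions n \<subseteq> ?M \<times> Pow {..n}"
  proof (intro subrelI)
    fix P S assume "(P, S) \<in> overpartitions n"
    then have *: "0 \<notin># P" "sum_mset P = n" "S \<subseteq> set_mset P"
      by (auto simp: overpartitions_def)
    have "set_mset P \<subseteq> {..n}"
      using *(2) by (auto dest: multi_member_split)
    moreover have "size P \<le> n"
      using size_le_sum_mset[OF *(1)] *(2) by simp
    moreover obtain xs where "P = mset xs"
      using ex_mset[of P] by metis
    ultimately show "(P, S) \<in> ?M \<times> Pow {..n}"
      using *(3) by auto
  qed
  show "finite (?M \<times> Pow {..n})"
    by (intro finite_cartesian_product finite_imageI finite_lists_length_le) auto
qed

lemma SOME_over_0: "SOME_over 0 = 0"
proof -
  have "P = {#}" if "(P, S) \<in> overpartitions 0" for P S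
    using that size_le_sum_mset[of P] unfolding overpartitions_def by force
  then show ?thesis
    unfolding SOME_over_def by (intro sum.neutral) fastforce
qed

end

theory Submission
  imports Defs "HOL-Computational_Algebra.Formal_Laurent_Series"
begin

text \<open>
  Let \<open>S(q)\<close> be the generating function of \<open>SOME_over\<close>, let \<open>theta(q)\<close> be the sum of \<open>q^(j\<^sup>2)\<close> over all
  integers \<open>j\<close>, and let \<open>D = q d/dq\<close>. The overpartition function is the product of
  \<open>(1 + q^k) / (1 - q^k)\<close>, which is \<open>1 / theta(-q)\<close> by Gauss's identity (\<open>gauss_finite\<close>,
  \<open>reflect_theta_overpartitions\<close>). Weighting the parts by their sign and size takes a logarithmic derivative
  with \<open>-q\<close> in place of \<open>q\<close> (\<open>weight_gf_log_derivative\<close>). Since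
  \<open>theta(q) theta(-q) = theta(-q\<^sup>2)\<^sup>2\<close>, this gives \<open>S(q) = D theta(q) / theta(-q\<^sup>2)\<^sup>2\<close>
  (\<open>SOME_gf_theta\<close>).

  Retaining only the coefficients at multiples of 4 and making the denominator a series in \<open>q\<^sup>2\<close> again, one
  obtains (\<open>multisect_SOME_gf\<close>)
  \<open>7 (\<Sum>n. SOME_over (4 n) q^n) = 4 D(theta(q)^7) / theta(-q\<^sup>2)^8\<close>.
  As \<open>theta\<close> is 1 modulo 2, the denominator is 1 modulo 16. The numerator is divisible by 8, and at
  even exponents even by 32. So, if \<open>r(n)\<close> denotes the coefficients of \<open>theta^7\<close>, that is, the number of
  representations of \<open>n\<close> as a sum of seven squares,
  \<open>7 SOME_over (4 n) \<equiv> 4 n r(n)\<close> modulo 128 and \<open>7 SOME_over (8 n) \<equiv> 8 n r(2 n)\<close> modulo 512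
  (\<open>SOME_over_mod_128\<close>, \<open>SOME_over_mod_512\<close>).

  Both claims now follow from \<open>r(4 n) \<equiv> r(n)\<close> modulo 16 (\<open>theta_power_mod_16\<close>), which holds because
  \<open>theta(q) = theta(q^4) + 2 q psi(q^4)\<close> with an integral series \<open>psi\<close>: in the seventh power of the right-hand
  side, the exponents divisible by 4 come only from the first term and from terms divisible by \<open>2^4\<close>.
  Replacing \<open>n\<close> by \<open>4 n\<close> thus multiplies the two right-hand sides by 4 modulo 128 and modulo 512.
\<close>

section \<open>A finite form of Gauss's theta identity\<close>

text \<open>
  For \<open>n\<close> tending to infinity, the terms with \<open>s \<ge> 1\<close> vanish and this becomes Gauss's identity
  \<open>(\<Sum>j. (-1)^j q^(j\<^sup>2)) \<cdot> (\<Prod>k. 1 + q^k) = (\<Prod>k. 1 - q^k)\<close>, the first sum being over all integers.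
  The finite version, in the style of Shanks, holds in every commutative ring and needs
  no infinite product: passing from \<open>n\<close> to \<open>M = n + 1\<close>, the right-hand side is multiplied by \<open>1 + q^M\<close>
  up to a telescoping sum, whose end term combines with the new summand \<open>s = M\<close> to the new term
  \<open>2 (-1)^M q^(M\<^sup>2)\<close> on the left. The factor \<open>1 + q^0 = 2\<close> in the product over \<open>k < s\<close> is
  intended: it is the 2 that comes from pairing \<open>j\<close> with \<open>-j\<close>.
\<close>
lemma gauss_finite:
  fixes q :: "'a :: comm_ring_1"
  shows "(1 + 2 * (\<Sum>j=1..n. (-1) ^ j * q ^ (j\<^sup>2))) * (\<Prod>k=1..n. 1 + q ^ k) =
    (\<Sum>s\<le>n. (-1) ^ s * q ^ (s * Suc n) * ((\<Prod>k\<in>{s<..n}. 1 - q ^ k) * (\<Prod>k<s. 1 + q ^ k)))"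
proof (induction n)
  case 0
  show ?case by simp
next
  case (Suc n)
  define M where "M = Suc n"
  define R where "R s = (\<Prod>k\<in>{s<..n}. 1 - q ^ k) * (\<Prod>k<s. 1 + q ^ k)" for s
  \<comment> \<open>\<open>- W t\<close> is the partial sum up to \<open>s = t\<close> of the difference between the new summands and
    \<open>1 + q ^ M\<close> times the old ones.\<close>
  define W where "W s = (-1) ^ s * q ^ (Suc s * M) * R s * (1 + q ^ s)" for s
  have step: "R (Suc s) * (1 - q ^ Suc s) = R s * (1 + q ^ s)" if "s < n" for s
  proof -
    have "{s<..n} = insert (Suc s) {Suc s<..n}"
      using that by auto
    thus ?thesis
      by (simp add: R_def algebra_simps)
  qed
  have telescope:
    "(\<Sum>s\<le>t. (-1) ^ s * q ^ (s * M) * R s * (q ^ s * (1 - q ^ M) - (1 + q ^ M))) = - W t"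
    if "t \<le> n" for t
    using that
  proof (induction t)
    case 0
    show ?case by (simp add: W_def algebra_simps)
  next
    case (Suc t)
    have "(-1) ^ Suc t * q ^ (Suc t * M) * R (Suc t) * (q ^ Suc t * (1 - q ^ M) - (1 + q ^ M))
        = (-1) ^ t * q ^ (Suc t * M) * (R (Suc t) * (1 - q ^ Suc t)) - W (Suc t)"
      by (simp add: W_def algebra_simps power_add)
    also have "R (Suc t) * (1 - q ^ Suc t) = R t * (1 + q ^ t)"
      by (rule step) (use Suc.prems in simp)
    also have "(-1) ^ t * q ^ (Suc t * M) * (R t * (1 + q ^ t)) = W t"
      by (simp only: W_def mult.assoc)
    finally show ?case
      using Suc by simp
  qed
  have top: "R n * (1 + q ^ n) = (\<Prod>k<M. 1 + q ^ k)"
    by (simp add: R_def M_def)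
  have double: "(\<Prod>k<M. 1 + q ^ k) = 2 * (\<Prod>k=1..n. 1 + q ^ k)"
    unfolding M_def by (simp add: prod.lessThan_Suc_shift prod.atLeast1_atMost_eq del: prod.lessThan_Suc)
  have "(\<Sum>s\<le>M. (-1) ^ s * q ^ (s * Suc M) * ((\<Prod>k\<in>{s<..M}. 1 - q ^ k) * (\<Prod>k<s. 1 + q ^ k)))
      = (\<Sum>s\<le>n. (-1) ^ s * q ^ (s * Suc M) * ((\<Prod>k\<in>{s<..M}. 1 - q ^ k) * (\<Prod>k<s. 1 + q ^ k)))
        + (-1) ^ M * q ^ (M * Suc M) * (\<Prod>k<M. 1 + q ^ k)"
    by (simp add: M_def del: prod.lessThan_Suc)
  also have "(\<Sum>s\<le>n. (-1) ^ s * q ^ (s * Suc M) * ((\<Prod>k\<in>{s<..M}. 1 - q ^ k) * (\<Prod>k<s. 1 + q ^ k)))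
      = (\<Sum>s\<le>n. (-1) ^ s * q ^ (s * M) * R s * (q ^ s * (1 - q ^ M) - (1 + q ^ M))
             + (1 + q ^ M) * ((-1) ^ s * q ^ (s * M) * R s))"
  proof (rule sum.cong)
    fix s assume "s \<in> {..n}"
    then have "{s<..M} = insert M {s<..n}"
      by (auto simp: M_def)
    then have peel: "(\<Prod>k\<in>{s<..M}. 1 - q ^ k) * (\<Prod>k<s. 1 + q ^ k) = (1 - q ^ M) * R s"
      by (simp add: R_def M_def mult.assoc)
    show "(-1) ^ s * q ^ (s * Suc M) * ((\<Prod>k\<in>{s<..M}. 1 - q ^ k) * (\<Prod>k<s. 1 + q ^ k))
      = (-1) ^ s * q ^ (s * M) * R s * (q ^ s * (1 - q ^ M) - (1 + q ^ M))
             + (1 + q ^ M) * ((-1) ^ s * q ^ (s * M) * R s)"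
      unfolding peel by (simp add: algebra_simps power_add)
  qed simp
  also have "\<dots> = - W n + (1 + q ^ M) * (\<Sum>s\<le>n. (-1) ^ s * q ^ (s * M) * R s)"
    using telescope[of n] by (simp add: sum.distrib sum_distrib_left)
  also have "(\<Sum>s\<le>n. (-1) ^ s * q ^ (s * M) * R s) =
      (1 + 2 * (\<Sum>j=1..n. (-1) ^ j * q ^ (j\<^sup>2))) * (\<Prod>k=1..n. 1 + q ^ k)"
    using Suc by (simp add: R_def M_def mult.assoc)
  also have "W n = (-1) ^ n * q ^ (M\<^sup>2) * (\<Prod>k<M. 1 + q ^ k)"
    unfolding top[symmetric] by (simp add: W_def M_def power2_eq_square mult.assoc)
  finally show ?case
    unfolding double by (simp add: M_def[symmetric]) (simp add: M_def algebra_simps power_add power2_eq_square)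
qed

section \<open>Overpartitions with bounded parts\<close>

definition bounded_overpartitions :: "nat \<Rightarrow> nat \<Rightarrow> (nat multiset \<times> nat set) set" where
  "bounded_overpartitions m n = {(P, S) \<in> overpartitions n. \<forall>k\<in>#P. k \<le> m}"

lemma finite_bounded_overpartitions: "finite (bounded_overpartitions m n)"
  by (rule finite_subset[OF _ finite_overpartitions[of n]]) (auto simp: bounded_overpartitions_def)

lemma bounded_overpartitions_0: "bounded_overpartitions 0 n = (if n = 0 then {({#}, {})} else {})"
proof -
  have "P = {#}" if "\<forall>k\<in>#P. k = 0" "0 \<notin># P" for P :: "nat multiset"
    using that by (metis multiset_nonemptyE)
  then have "bounded_overpartitions 0 n = {(P, S). P = {#} \<and> S = {} \<and> n = 0}"
    unfolding bounded_overpartitions_def overpartitions_def by fastforce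
  then show ?thesis
    by auto
qed

lemma bounded_overpartitions_eq: "n \<le> m \<Longrightarrow> bounded_overpartitions m n = overpartitions n"
  by (fastforce simp: bounded_overpartitions_def overpartitions_def dest: multi_member_split)

text \<open>
  An overpartition with parts at most \<open>m + 1\<close> either has no part \<open>m + 1\<close>, or arises by adding a plain
  copy of \<open>m + 1\<close> to an arbitrary overpartition with the same bound, or has \<open>m + 1\<close> exactly once and
  overlined. Removing only one copy at a time avoids a sum over the multiplicity of \<open>m + 1\<close>.
\<close>
lemma sum_bounded_overpartitions_Suc:
  fixes f :: "nat multiset \<Rightarrow> 'a :: comm_monoid_add"
  defines "A \<equiv> \<lambda>m n f. \<Sum>(P, S)\<in>bounded_overpartitions m n. f P"
  shows "A (Suc m) n f = A m n f + (if Suc m \<le> n then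
     A (Suc m) (n - Suc m) (\<lambda>P. f (add_mset (Suc m) P)) +
     A m (n - Suc m) (\<lambda>P. f (add_mset (Suc m) P)) else 0)"
proof -
  define plain where "plain = (\<lambda>(P, S :: nat set). (add_mset (Suc m) P, S))"
  define over where "over = (\<lambda>(P, S). (add_mset (Suc m) P, insert (Suc m) S))"
  define B where "B = (if Suc m \<le> n then plain ` bounded_overpartitions (Suc m) (n - Suc m) else {})"
  define C where "C = (if Suc m \<le> n then over ` bounded_overpartitions m (n - Suc m) else {})"
  have notin: "Suc m \<notin># P" "Suc m \<notin> S" if "(P, S) \<in> bounded_overpartitions m k" for P S k
    using that by (force simp: bounded_overpartitions_def overpartitions_def)+
  have split: "bounded_overpartitions (Suc m) n = bounded_overpartitions m n \<union> (B \<union> C)"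
  proof (intro equalityI subrelI)
    fix P S assume PS: "(P, S) \<in> bounded_overpartitions (Suc m) n"
    show "(P, S) \<in> bounded_overpartitions m n \<union> (B \<union> C)"
    proof (cases "Suc m \<in># P")
      case False
      then show ?thesis
        using PS by (auto simp: bounded_overpartitions_def le_Suc_eq)
    next
      case True
      then obtain P' where P': "P = add_mset (Suc m) P'"
        by (meson multi_member_split)
      have le: "Suc m \<le> n"
        using PS by (auto simp: bounded_overpartitions_def overpartitions_def P')
      show ?thesis
      proof (cases "Suc m \<in> S \<and> Suc m \<notin># P'")
        case True
        then have "(P', S - {Suc m}) \<in> bounded_overpartitions m (n - Suc m)"
          using PS by (auto simp: bounded_overpartitions_def overpartitions_def P' le_Suc_eq)
        moreover have "(P, S) = over (P', S - {Suc m})"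
          using True by (auto simp: over_def P')
        ultimately show ?thesis
          using le by (auto simp: C_def)
      next
        case False
        then have "(P', S) \<in> bounded_overpartitions (Suc m) (n - Suc m)"
          using PS by (auto simp: bounded_overpartitions_def overpartitions_def P')
        moreover have "(P, S) = plain (P', S)"
          by (auto simp: plain_def P')
        ultimately show ?thesis
          using le by (auto simp: B_def)
      qed
    qed
  next
    fix P S assume "(P, S) \<in> bounded_overpartitions m n \<union> (B \<union> C)"
    then show "(P, S) \<in> bounded_overpartitions (Suc m) n"
      by (auto simp: B_def C_def plain_def over_def bounded_overpartitions_def overpartitions_def
               le_SucI split: if_splits)
  qed
  have fin: "finite B" "finite C"
    by (auto simp: B_def C_def finite_bounded_overpartitions)
  have disj1: "bounded_overpartitions m n \<inter> (B \<union> C) = {}"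
    using notin(1) by (force simp: B_def C_def plain_def over_def split: if_splits)
  have disj2: "B \<inter> C = {}"
    using notin(1) by (auto simp: B_def C_def plain_def over_def bounded_overpartitions_def overpartitions_def split: if_splits)
  have inj1: "inj_on plain X" for X
    by (auto simp: inj_on_def plain_def)
  have inj2: "inj_on over (bounded_overpartitions m k)" for k
  proof (rule inj_onI, clarify)
    fix P S P' S'
    assume "(P, S) \<in> bounded_overpartitions m k" "(P', S') \<in> bounded_overpartitions m k"
      and "over (P, S) = over (P', S')"
    then show "P = P' \<and> S = S'"
      using notin(2)[of P S k] notin(2)[of P' S' k] by (simp add: over_def insert_ident)
  qed
  have "A (Suc m) n f = A m n f + ((\<Sum>(P, S)\<in>B. f P) + (\<Sum>(P, S)\<in>C. f P))"
    unfolding A_def split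
    by (simp add: sum.union_disjoint finite_bounded_overpartitions fin disj1 disj2)
  also have "(\<Sum>(P, S)\<in>B. f P) =
      (if Suc m \<le> n then A (Suc m) (n - Suc m) (\<lambda>P. f (add_mset (Suc m) P)) else 0)"
    by (simp add: A_def B_def sum.reindex[OF inj1]) (simp add: plain_def case_prod_unfold)
  also have "(\<Sum>(P, S)\<in>C. f P) =
      (if Suc m \<le> n then A m (n - Suc m) (\<lambda>P. f (add_mset (Suc m) P)) else 0)"
    by (simp add: A_def C_def sum.reindex[OF inj2]) (simp add: over_def case_prod_unfold)
  finally show ?thesis
    by simp
qed

section \<open>Generating functions of overpartitions with bounded parts\<close>

definition overpartition_gf :: "(nat multiset \<Rightarrow> int) \<Rightarrow> nat \<Rightarrow> int fps" where
  "overpartition_gf f m = Abs_fps (\<lambda>n. \<Sum>(P, S)\<in>bounded_overpartitions m n. f P)"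

lemma overpartition_gf_0: "overpartition_gf f 0 = fps_const (f {#})"
  by (auto simp: overpartition_gf_def fps_eq_iff bounded_overpartitions_0)

lemma overpartition_gf_Suc:
  "overpartition_gf f (Suc m) = overpartition_gf f m + fps_X ^ Suc m *
     (overpartition_gf (\<lambda>P. f (add_mset (Suc m) P)) (Suc m) +
      overpartition_gf (\<lambda>P. f (add_mset (Suc m) P)) m)"
  by (rule fps_ext)
     (simp add: fps_X_power_mult_nth overpartition_gf_def sum_bounded_overpartitions_Suc[of f m]
           del: power_Suc)

lemma overpartition_gf_linear:
  "overpartition_gf (\<lambda>P. c + f P) m = of_int c * overpartition_gf (\<lambda>_. 1) m + overpartition_gf f m"
  by (rule fps_ext)
     (simp add: overpartition_gf_def fps_of_int[symmetric] case_prod_unfold sum.distrib)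

definition odd_minus_even :: "nat multiset \<Rightarrow> int" where
  "odd_minus_even P = int (\<Sum>k\<in>#filter_mset odd P. k) - int (\<Sum>k\<in>#filter_mset even P. k)"

lemma odd_minus_even_empty: "odd_minus_even {#} = 0"
  by (simp add: odd_minus_even_def)

lemma odd_minus_even_add: "odd_minus_even (add_mset k P) = - ((-1) ^ k * int k) + odd_minus_even P"
  by (simp add: odd_minus_even_def)

definition count_gf :: "nat \<Rightarrow> int fps" where "count_gf = overpartition_gf (\<lambda>_. 1)"
definition weight_gf :: "nat \<Rightarrow> int fps" where "weight_gf = overpartition_gf odd_minus_even"

lemma count_gf_0: "count_gf 0 = 1"
  by (simp add: count_gf_def overpartition_gf_0)

lemma count_gf_Suc:
  "(1 - fps_X ^ Suc m) * count_gf (Suc m) = (1 + fps_X ^ Suc m) * count_gf m"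
  using overpartition_gf_Suc[of "\<lambda>_. 1" m] by (simp add: count_gf_def algebra_simps)

lemma weight_gf_0: "weight_gf 0 = 0"
  by (simp add: weight_gf_def overpartition_gf_0 odd_minus_even_empty)

lemma weight_gf_Suc:
  "(1 - fps_X ^ Suc m) * weight_gf (Suc m) = (1 + fps_X ^ Suc m) * weight_gf m
     - of_nat (Suc m) * (- fps_X) ^ Suc m * (count_gf (Suc m) + count_gf m)"
proof -
  have "weight_gf (Suc m) = weight_gf m + fps_X ^ Suc m *
     (weight_gf (Suc m) + weight_gf m -
       (-1) ^ Suc m * of_nat (Suc m) * (count_gf (Suc m) + count_gf m))"
    using overpartition_gf_Suc[of odd_minus_even m]
    unfolding odd_minus_even_add overpartition_gf_linear weight_gf_def[symmetric] count_gf_def[symmetric]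
    by (simp add: algebra_simps del: power_Suc of_nat_Suc)
  then show ?thesis
    unfolding power_minus[of fps_X] by (simp add: algebra_simps del: power_Suc of_nat_Suc)
qed

section \<open>Substituting \<open>-q\<close> and \<open>q^k\<close> into power series\<close>

abbreviation reflect :: "int fps \<Rightarrow> int fps" where
  "reflect F \<equiv> fps_compose F (- fps_X)"

abbreviation dilate :: "nat \<Rightarrow> int fps \<Rightarrow> int fps" where
  "dilate k F \<equiv> fps_compose F (fps_X ^ k)"

lemma reflect_nth: "reflect F $ n = (-1) ^ n * F $ n"
  by (simp add: fps_compose_uminus')

lemma reflect_reflect: "reflect (reflect F) = F"
  by (rule fps_ext) (simp add: reflect_nth flip: mult.assoc power_mult_distrib)

lemma reflect_mult: "reflect (F * G) = reflect F * reflect G"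
  by (simp add: fps_compose_mult_distrib)

lemma reflect_power: "reflect (F ^ k) = reflect F ^ k"
  by (simp add: fps_compose_power)

lemma dilate_mult: "0 < k \<Longrightarrow> dilate k (F * G) = dilate k F * dilate k G"
  by (simp add: fps_compose_mult_distrib)

lemma dilate_power: "0 < k \<Longrightarrow> dilate k (F ^ n) = dilate k F ^ n"
  by (simp add: fps_compose_power)

lemma dilate_nth: "0 < k \<Longrightarrow> dilate k F $ n = (if k dvd n then F $ (n div k) else 0)"
  by (simp add: fps_nth_compose_X_power)

lemma fps_XD_mult: "fps_XD (F * G) = fps_XD F * G + F * fps_XD (G :: int fps)"
  by (simp add: fps_XD_def algebra_simps)

lemma fps_XD_power: "fps_XD (F ^ Suc n) = of_nat (Suc n) * F ^ n * fps_XD (F :: int fps)"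
  by (simp add: fps_XD_def fps_deriv_power algebra_simps fps_of_nat[symmetric] del: of_nat_Suc power_Suc)

section \<open>The logarithmic derivative of the overpartition function\<close>

text \<open>
  Write \<open>P(q)\<close> for \<open>count_gf m\<close>, the product of \<open>(1 + q^k) / (1 - q^k)\<close> over \<open>k \<le> m\<close>, and \<open>D\<close> for
  \<open>q d/dq\<close>. A part \<open>k\<close> contributes \<open>- (-1)^k k \<cdot> 2 q^k / (1 - q^(2k))\<close> to \<open>weight_gf m / P(q)\<close>, which is
  exactly the negative of its contribution to the logarithmic derivative \<open>D P(-q) / P(-q)\<close>. So the sign
  that distinguishes odd from even parts is absorbed by the substitution of \<open>-q\<close>.
\<close>
lemma weight_gf_log_derivative:
  "weight_gf m * reflect (count_gf m) = - (count_gf m * fps_XD (reflect (count_gf m)))"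
proof (induction m)
  case 0
  show ?case by (simp add: weight_gf_0 count_gf_0 fps_XD_def)
next
  case (Suc m)
  define x where "x = (fps_X :: int fps) ^ Suc m"
  define y where "y = (- fps_X :: int fps) ^ Suc m"
  define c where "c = (of_nat (Suc m) :: int fps)"
  define P where "P = count_gf m"
  define P' where "P' = count_gf (Suc m)"
  define S where "S = weight_gf m"
  define S' where "S' = weight_gf (Suc m)"
  define Q where "Q = reflect P"
  define Q' where "Q' = reflect P'"
  have refl_x: "reflect x = y"
    by (simp add: x_def y_def fps_X_power_compose del: power_Suc)
  have P': "(1 - x) * P' = (1 + x) * P"
    using count_gf_Suc[of m] by (simp only: x_def P_def P'_def)
  have S': "(1 - x) * S' = (1 + x) * S - c * y * (P' + P)"
    using weight_gf_Suc[of m] by (simp only: x_def y_def c_def P_def P'_def S_def S'_def)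
  have Q': "(1 - y) * Q' = (1 + y) * Q"
    using arg_cong[OF P', of reflect]
    by (simp add: fps_compose_mult_distrib fps_compose_sub_distrib fps_compose_add_distrib refl_x
         Q_def Q'_def)
  have Dy: "fps_XD y = c * y"
    unfolding y_def c_def fps_XD_power by (simp add: fps_XD_def)
  have D1: "fps_XD (1 - y) = - (c * y)" "fps_XD (1 + y) = c * y"
    using Dy by (simp_all add: fps_XD_def)
  have DQ': "(1 - y) * fps_XD Q' = (1 + y) * fps_XD Q + c * y * (Q' + Q)"
    using arg_cong[OF Q', of fps_XD, unfolded fps_XD_mult D1]
    by (simp add: algebra_simps)
  have IH: "S * Q = - (P * fps_XD Q)"
    using Suc by (simp add: S_def Q_def P_def)
  have P2: "(1 - x) * (P' + P) = 2 * P" and Q2: "(1 - y) * (Q' + Q) = 2 * Q"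
    using P' Q' by (simp_all add: algebra_simps)
  have xy: "y ^ 2 = x ^ 2"
    by (simp add: x_def y_def power_minus[of fps_X] power_mult_distrib flip: power_mult)
  \<comment> \<open>Clearing the denominators \<open>1 - x\<close> and \<open>1 - y\<close> reduces the claim to the induction hypothesis
    and the relation \<open>y\<^sup>2 = x\<^sup>2\<close>.\<close>
  have "(1 - x) ^ 2 * (1 - y) ^ 2 * (S' * Q') = (1 - x) * (1 - y) * (((1 - x) * S') * ((1 - y) * Q'))"
    by (simp add: power2_eq_square mult_ac)
  also have "\<dots> = (1 - x) * (1 - y) * (1 + x) * (1 + y) * (S * Q)
      - c * y * (1 - y) * (1 + y) * Q * ((1 - x) * (P' + P))"
    unfolding S' Q' by (simp add: algebra_simps)
  finally have 1: "(1 - x) ^ 2 * (1 - y) ^ 2 * (S' * Q') =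
      - ((1 - x) * (1 - y) * (1 + x) * (1 + y) * (P * fps_XD Q)) - 2 * c * y * P * Q * (1 - y\<^sup>2)"
    unfolding P2 IH by (simp add: algebra_simps power2_eq_square)
  have "(1 - x) ^ 2 * (1 - y) ^ 2 * (P' * fps_XD Q') =
      (1 - x) * (1 - y) * (((1 - x) * P') * ((1 - y) * fps_XD Q'))"
    by (simp add: power2_eq_square mult_ac)
  also have "\<dots> = (1 - x) * (1 - y) * (1 + x) * (1 + y) * (P * fps_XD Q)
      + c * y * (1 - x) * (1 + x) * P * ((1 - y) * (Q' + Q))"
    unfolding P' DQ' by (simp add: algebra_simps)
  finally have 2: "(1 - x) ^ 2 * (1 - y) ^ 2 * (P' * fps_XD Q') =
      (1 - x) * (1 - y) * (1 + x) * (1 + y) * (P * fps_XD Q) + 2 * c * y * P * Q * (1 - x\<^sup>2)"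
    unfolding Q2 by (simp add: algebra_simps power2_eq_square)
  have "(1 - x) ^ 2 * (1 - y) ^ 2 * (S' * Q' + P' * fps_XD Q') = 0"
    unfolding distrib_left[of _ "S' * Q'"] 1 2 xy by simp
  moreover have "1 - x \<noteq> 0" "1 - y \<noteq> 0"
    by (auto simp: x_def y_def fps_eq_iff intro!: exI[of _ 0])
  ultimately have "S' * Q' + P' * fps_XD Q' = 0"
    by simp
  then show ?case
    by (simp add: S'_def Q'_def P'_def eq_neg_iff_add_eq_0)
qed

text \<open>
  For odd \<open>k\<close> the factors \<open>(1 + q^k) / (1 - q^k)\<close> and their images under \<open>q \<mapsto> -q\<close> are reciprocal, and
  for even \<open>k\<close> they are equal.
\<close>
lemma count_gf_reflect:
  "count_gf (2 * m) * reflect (count_gf (2 * m)) = dilate 2 ((count_gf m)\<^sup>2)"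
proof (induction m)
  case 0
  show ?case by (simp add: count_gf_0)
next
  case (Suc m)
  define x where "x = (fps_X :: int fps) ^ Suc (2 * m)"
  define z where "z = (fps_X :: int fps) ^ Suc (Suc (2 * m))"
  define A where "A = count_gf (2 * m)"
  define B where "B = count_gf (Suc (2 * m))"
  define C where "C = count_gf (Suc (Suc (2 * m)))"
  define F where "F = dilate 2 (count_gf m)"
  define G where "G = dilate 2 (count_gf (Suc m))"
  have refl: "reflect x = - x" "reflect z = z"
    by (simp_all add: x_def z_def fps_X_power_compose del: power_Suc)
  have B: "(1 - x) * B = (1 + x) * A" and C: "(1 - z) * C = (1 + z) * B"
    using count_gf_Suc[of "2 * m"] count_gf_Suc[of "Suc (2 * m)"]
    by (simp_all only: x_def z_def A_def B_def C_def)
  have B': "(1 + x) * reflect B = (1 - x) * reflect A"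
    using arg_cong[OF B, of reflect]
    by (simp add: fps_compose_mult_distrib fps_compose_sub_distrib fps_compose_add_distrib refl)
  have C': "(1 - z) * reflect C = (1 + z) * reflect B"
    using arg_cong[OF C, of reflect]
    by (simp add: fps_compose_mult_distrib fps_compose_sub_distrib fps_compose_add_distrib refl)
  have dz: "dilate 2 (fps_X ^ Suc m) = z"
    by (simp add: z_def fps_X_power_compose flip: power_mult power_Suc)
  have G: "(1 - z) * G = (1 + z) * F"
    using arg_cong[OF count_gf_Suc[of m], of "dilate 2"] dz
    by (simp add: fps_compose_mult_distrib fps_compose_sub_distrib fps_compose_add_distrib F_def G_def
          del: power_Suc)
  have IH: "A * reflect A = F\<^sup>2"
    using Suc by (simp add: A_def F_def dilate_power)
  have "(1 - x) * (1 + x) * (1 - z)\<^sup>2 * (C * reflect C) =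
      (1 - x) * (1 + x) * (((1 - z) * C) * ((1 - z) * reflect C))"
    by (simp only: power2_eq_square mult_ac)
  also have "\<dots> = (1 + z)\<^sup>2 * (((1 - x) * B) * ((1 + x) * reflect B))"
    unfolding C C' by (simp only: power2_eq_square mult_ac)
  also have "\<dots> = (1 - x) * (1 + x) * ((1 + z)\<^sup>2 * (A * reflect A))"
    unfolding B B' by (simp only: power2_eq_square mult_ac)
  also have "\<dots> = (1 - x) * (1 + x) * ((1 - z) * G)\<^sup>2"
    unfolding IH G by (simp only: power_mult_distrib)
  also have "\<dots> = (1 - x) * (1 + x) * (1 - z)\<^sup>2 * G\<^sup>2"
    by (simp only: power_mult_distrib mult.assoc)
  finally have "(1 - x) * (1 + x) * (1 - z)\<^sup>2 * (C * reflect C - G\<^sup>2) = 0"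
    by (subst right_diff_distrib) (simp only: diff_self)
  moreover have "1 - x \<noteq> 0" "1 - z \<noteq> 0" "1 + x \<noteq> 0"
    by (auto simp: x_def z_def fps_eq_iff intro!: exI[of _ 0])
  ultimately have "C * reflect C - G\<^sup>2 = 0"
    by simp
  then show ?case
    by (simp add: C_def G_def dilate_power)
qed

section \<open>Passing to all overpartitions\<close>

definition overpartitions_gf :: "int fps" where
  "overpartitions_gf = Abs_fps (\<lambda>n. int (card (overpartitions n)))"

definition SOME_gf :: "int fps" where
  "SOME_gf = Abs_fps SOME_over"

lemma tendsto_fps_mult:
  fixes F G :: "'b \<Rightarrow> 'a :: ring fps"
  assumes "(F \<longlongrightarrow> F') L" "(G \<longlongrightarrow> G') L"
  shows "((\<lambda>x. F x * G x) \<longlongrightarrow> F' * G') L"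
proof (rule tendsto_fpsI)
  fix n
  have "eventually (\<lambda>x. \<forall>i\<in>{..n}. F x $ i = F' $ i \<and> G x $ i = G' $ i) L"
    using assms by (subst eventually_ball_finite_distrib) (auto simp: tendsto_fps_iff eventually_conj)
  then show "eventually (\<lambda>x. (F x * G x) $ n = (F' * G') $ n) L"
    by eventually_elim (simp add: fps_mult_nth)
qed

lemma count_gf_tendsto: "count_gf \<longlonglongrightarrow> overpartitions_gf"
proof (rule tendsto_fpsI)
  fix n
  show "\<forall>\<^sub>F m in sequentially. count_gf m $ n = overpartitions_gf $ n"
    by (rule eventually_sequentiallyI[of n])
       (simp add: count_gf_def overpartition_gf_def overpartitions_gf_def bounded_overpartitions_eq)
qed

lemma weight_gf_tendsto: "weight_gf \<longlonglongrightarrow> SOME_gf"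
proof (rule tendsto_fpsI)
  fix n
  show "\<forall>\<^sub>F m in sequentially. weight_gf m $ n = SOME_gf $ n"
    by (rule eventually_sequentiallyI[of n])
       (simp add: weight_gf_def overpartition_gf_def SOME_gf_def SOME_over_def odd_minus_even_def
          bounded_overpartitions_eq)
qed

lemma tendsto_reflect: "(F \<longlongrightarrow> G) L \<Longrightarrow> ((\<lambda>x. reflect (F x)) \<longlongrightarrow> reflect G) L"
  unfolding tendsto_fps_iff by (auto simp: reflect_nth elim!: eventually_mono dest: spec)

lemma tendsto_XD: "(F \<longlongrightarrow> G) L \<Longrightarrow> ((\<lambda>x. fps_XD (F x :: int fps)) \<longlongrightarrow> fps_XD G) L"
  unfolding tendsto_fps_iff by (auto elim!: eventually_mono dest: spec)

lemma tendsto_dilate: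
  "(F \<longlongrightarrow> G) L \<Longrightarrow> 0 < k \<Longrightarrow> ((\<lambda>x. dilate k (F x)) \<longlongrightarrow> dilate k G) L"
  unfolding tendsto_fps_iff by (auto simp: dilate_nth)

lemma tendsto_fps_uminus: "(F \<longlongrightarrow> G) L \<Longrightarrow> ((\<lambda>x. - F x :: int fps) \<longlongrightarrow> - G) L"
  unfolding tendsto_fps_iff by (auto elim!: eventually_mono dest: spec)

text \<open>
  Each coefficient of \<open>count_gf m\<close> and \<open>weight_gf m\<close> is eventually constant in \<open>m\<close>, so both converge in
  the coefficientwise topology and the identities for bounded parts pass to the limit.
\<close>
lemma SOME_gf_log_derivative:
  "SOME_gf * reflect overpartitions_gf = - (overpartitions_gf * fps_XD (reflect overpartitions_gf))"
proof (rule LIMSEQ_unique)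
  show "(\<lambda>m. weight_gf m * reflect (count_gf m)) \<longlonglongrightarrow> SOME_gf * reflect overpartitions_gf"
    by (intro tendsto_fps_mult tendsto_reflect count_gf_tendsto weight_gf_tendsto)
  show "(\<lambda>m. weight_gf m * reflect (count_gf m)) \<longlonglongrightarrow>
      - (overpartitions_gf * fps_XD (reflect overpartitions_gf))"
    unfolding weight_gf_log_derivative
    by (intro tendsto_fps_uminus tendsto_fps_mult tendsto_XD tendsto_reflect count_gf_tendsto)
qed

lemma overpartitions_gf_reflect:
  "overpartitions_gf * reflect overpartitions_gf = dilate 2 (overpartitions_gf\<^sup>2)"
proof (rule LIMSEQ_unique)
  have "filterlim (\<lambda>m::nat. 2 * m) sequentially sequentially"
    by (intro filterlim_subseq) (auto simp: strict_mono_def)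
  then have *: "(\<lambda>m. count_gf (2 * m)) \<longlonglongrightarrow> overpartitions_gf"
    by (rule filterlim_compose[OF count_gf_tendsto])
  show "(\<lambda>m. count_gf (2 * m) * reflect (count_gf (2 * m))) \<longlonglongrightarrow>
      overpartitions_gf * reflect overpartitions_gf"
    by (intro tendsto_fps_mult tendsto_reflect *)
  show "(\<lambda>m. count_gf (2 * m) * reflect (count_gf (2 * m))) \<longlonglongrightarrow> dilate 2 (overpartitions_gf\<^sup>2)"
    unfolding count_gf_reflect
  proof (rule tendsto_dilate)
    show "(\<lambda>m. (count_gf m)\<^sup>2) \<longlonglongrightarrow> overpartitions_gf\<^sup>2"
      unfolding power2_eq_square by (intro tendsto_fps_mult count_gf_tendsto)
  qed simp
qed

section \<open>The generating function as a theta quotient\<close>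

text \<open>This is the sum of \<open>q^(j\<^sup>2)\<close> over all integers \<open>j\<close>.\<close>
definition theta :: "int fps" where
  "theta = Abs_fps (\<lambda>n. if n = 0 then 1 else if \<exists>j. n = j\<^sup>2 then 2 else 0)"

lemma reflect_theta_tendsto:
  "(\<lambda>n. 1 + 2 * (\<Sum>j=1..n. (-1) ^ j * fps_X ^ (j\<^sup>2))) \<longlonglongrightarrow> reflect theta"
proof (rule tendsto_fpsI, rule eventually_sequentiallyI)
  fix i n :: nat assume "i \<le> n"
  have "(\<Sum>j=1..n. (-1) ^ j * fps_X ^ (j\<^sup>2) :: int fps) $ i =
     (\<Sum>j=1..n. if i = j\<^sup>2 then (-1) ^ j else 0)"
  proof -
    have "((-1) ^ j * fps_X ^ (j\<^sup>2) :: int fps) $ i = (if i = j\<^sup>2 then (-1) ^ j else 0)" for j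
      by (cases "even j") (auto simp: fps_X_power_nth)
    then show ?thesis
      by (simp add: fps_sum_nth)
  qed
  also have "\<dots> = (if i \<noteq> 0 \<and> (\<exists>j. i = j\<^sup>2) then (-1) ^ i else 0)"
  proof (cases "i \<noteq> 0 \<and> (\<exists>j. i = j\<^sup>2)")
    case True
    then obtain a where a: "i = a\<^sup>2" "a \<noteq> 0"
      by auto
    then have "a \<le> n"
      using \<open>i \<le> n\<close> by (metis le_trans power2_nat_le_imp_le)
    then have "(\<Sum>j=1..n. if i = j\<^sup>2 then (-1) ^ j else (0::int)) =
       (\<Sum>j\<in>{a}. (-1) ^ j)"
      using a by (intro sum.mono_neutral_cong_right) auto
    then show ?thesis
      using True by (simp add: a minus_one_power_iff)
  qed (auto intro!: sum.neutral)
  finally show "(1 + 2 * (\<Sum>j=1..n. (-1) ^ j * fps_X ^ (j\<^sup>2))) $ i = reflect theta $ i"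
    by (simp add: reflect_nth theta_def numeral_fps_const minus_one_power_iff)
qed

lemma count_gf_product:
  "count_gf m * (\<Prod>k=1..m. 1 - fps_X ^ k) = (\<Prod>k=1..m. 1 + fps_X ^ k)"
proof (induction m)
  case 0
  show ?case by (simp add: count_gf_0)
next
  case (Suc m)
  have "count_gf (Suc m) * (\<Prod>k=1..Suc m. 1 - fps_X ^ k)
      = ((1 - fps_X ^ Suc m) * count_gf (Suc m)) * (\<Prod>k=1..m. 1 - fps_X ^ k)"
    by (simp add: mult_ac del: power_Suc)
  also have "\<dots> = (1 + fps_X ^ Suc m) * (count_gf m * (\<Prod>k=1..m. 1 - fps_X ^ k))"
    unfolding count_gf_Suc by (simp only: mult.assoc)
  also have "\<dots> = (\<Prod>k=1..Suc m. 1 + fps_X ^ k)"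
    unfolding Suc by (simp add: mult_ac del: power_Suc)
  finally show ?case .
qed

lemma fps_nth_eq_0_if_mult_unit:
  fixes H U :: "'a :: comm_ring_1 fps"
  assumes "U $ 0 = 1" "\<And>i. i \<le> n \<Longrightarrow> (H * U) $ i = 0" "i \<le> n"
  shows "H $ i = 0"
  using \<open>i \<le> n\<close>
proof (induction i rule: less_induct)
  case (less i)
  have "(H * U) $ i = (\<Sum>j=0..i. H $ j * U $ (i - j))"
    by (simp add: fps_mult_nth)
  also have "\<dots> = (\<Sum>j\<in>{i}. H $ j * U $ (i - j))"
    using less by (intro sum.mono_neutral_right) auto
  finally show ?case
    using assms less.prems by simp
qed

text \<open>
  Gauss's identity in the form \<open>theta(-q) = (\<Prod>k. (1 - q^k) / (1 + q^k))\<close>, so that overpartitions are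
  counted by \<open>1 / theta(-q)\<close>. In the finite form, all summands with \<open>s \<ge> 1\<close> are divisible by
  \<open>q^(n + 1)\<close>, which leaves only the summand \<open>s = 0\<close> in the coefficients up to \<open>n\<close>.
\<close>
lemma reflect_theta_overpartitions: "reflect theta * overpartitions_gf = 1"
proof (rule LIMSEQ_unique)
  define L where "L n = (1 + 2 * (\<Sum>j=1..n. (-1) ^ j * fps_X ^ (j\<^sup>2)) :: int fps)" for n
  show "(\<lambda>n. L n * count_gf n) \<longlonglongrightarrow> reflect theta * overpartitions_gf"
    unfolding L_def by (intro tendsto_fps_mult reflect_theta_tendsto count_gf_tendsto)
  have "(L n * count_gf n - 1) $ i = 0" if "i \<le> n" for i n
  proof (rule fps_nth_eq_0_if_mult_unit[OF _ _ that])
    define U where "U = (\<Prod>k=1..n. 1 - fps_X ^ k :: int fps)"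
    define E where "E s = (\<Prod>k\<in>{s<..n}. 1 - fps_X ^ k) * (\<Prod>k<s. 1 + fps_X ^ k :: int fps)" for s
    show "(\<Prod>k=1..n. 1 - fps_X ^ k :: int fps) $ 0 = 1"
      by (induction n) simp_all
    fix i assume i: "i \<le> n"
    have "L n * count_gf n * U = L n * (\<Prod>k=1..n. 1 + fps_X ^ k)"
      unfolding count_gf_product[symmetric] U_def by (simp add: mult_ac)
    also have "\<dots> = (\<Sum>s\<le>n. (-1) ^ s * fps_X ^ (s * Suc n) * E s)"
      unfolding L_def E_def by (rule gauss_finite)
    also have "\<dots> = E 0 + (\<Sum>s\<in>{1..n}. (-1) ^ s * fps_X ^ (s * Suc n) * E s)"
      by (simp add: atMost_atLeast0 sum.atLeast_Suc_atMost)
    also have "E 0 = U"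
      by (simp add: E_def U_def atLeastSucAtMost_greaterThanAtMost)
    also have "(\<Sum>s\<in>{1..n}. (-1) ^ s * fps_X ^ (s * Suc n) * E s) =
        (\<Sum>s\<in>{1..n}. fps_X ^ (s * Suc n) * ((-1) ^ s * E s))"
      by (simp only: mult_ac)
    finally have "(L n * count_gf n - 1) * U = (\<Sum>s\<in>{1..n}. fps_X ^ (s * Suc n) * ((-1) ^ s * E s))"
      by (simp add: algebra_simps)
    also have "\<dots> $ i = 0"
      unfolding fps_sum_nth
    proof (intro sum.neutral ballI)
      fix s assume "s \<in> {1..n}"
      then have "1 * Suc n \<le> s * Suc n"
        by (intro mult_le_mono1) simp
      then show "(fps_X ^ (s * Suc n) * ((-1) ^ s * E s)) $ i = 0"
        using i by (subst fps_X_power_mult_nth) simp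
    qed
    finally show "((L n * count_gf n - 1) * (\<Prod>k=1..n. 1 - fps_X ^ k)) $ i = 0"
      by (simp add: U_def)
  qed
  then have "(L n * count_gf n) $ i = 1 $ i" if "i \<le> n" for i n
    using that by simp
  then show "(\<lambda>n. L n * count_gf n) \<longlonglongrightarrow> 1"
    by (intro tendsto_fpsI eventually_sequentiallyI)
qed

lemma theta_reflect_overpartitions: "theta * reflect overpartitions_gf = 1"
  using arg_cong[OF reflect_theta_overpartitions, of reflect]
  by (simp add: reflect_mult reflect_reflect)

text \<open>
  Jacobi's \<open>theta(q) theta(-q) = theta(-q\<^sup>2)\<^sup>2\<close>, read off from the product formula by way of
  \<open>overpartitions_gf_reflect\<close>.
\<close>
lemma theta_mult_reflect: "theta * reflect theta = dilate 2 ((reflect theta)\<^sup>2)"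
proof -
  let ?P = overpartitions_gf
  have "dilate 2 ((reflect theta)\<^sup>2) = dilate 2 ((reflect theta)\<^sup>2) *
      ((theta * reflect ?P) * (reflect theta * ?P))"
    by (simp add: reflect_theta_overpartitions theta_reflect_overpartitions)
  also have "\<dots> = theta * reflect theta * (dilate 2 ((reflect theta)\<^sup>2) * (?P * reflect ?P))"
    by (simp only: mult_ac)
  also have "dilate 2 ((reflect theta)\<^sup>2) * (?P * reflect ?P) = dilate 2 ((reflect theta * ?P)\<^sup>2)"
    by (simp add: overpartitions_gf_reflect dilate_mult power_mult_distrib)
  finally show ?thesis
    by (simp add: reflect_theta_overpartitions)
qed

text \<open>
  As \<open>reflect overpartitions_gf = 1 / theta\<close>, the logarithmic derivative turns into
  \<open>D theta / (theta(q) theta(-q))\<close>.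
\<close>
lemma SOME_gf_theta: "SOME_gf * dilate 2 ((reflect theta)\<^sup>2) = fps_XD theta"
proof -
  let ?P = overpartitions_gf
  have D: "theta * fps_XD (reflect ?P) = - (fps_XD theta * reflect ?P)"
    using arg_cong[OF theta_reflect_overpartitions, of fps_XD]
    by (simp add: fps_XD_mult eq_neg_iff_add_eq_0 add.commute) (simp add: fps_XD_def)
  have "SOME_gf * (theta * reflect theta) =
      SOME_gf * (theta * reflect theta) * (theta * reflect ?P)"
    by (simp add: theta_reflect_overpartitions)
  also have "\<dots> = theta * theta * reflect theta * (SOME_gf * reflect ?P)"
    by (simp only: mult_ac)
  also have "\<dots> = - (theta * (theta * fps_XD (reflect ?P)) * (reflect theta * ?P))"
    unfolding SOME_gf_log_derivative by (simp add: mult_ac)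
  also have "\<dots> = fps_XD theta * (theta * reflect ?P)"
    unfolding D reflect_theta_overpartitions by (simp add: mult_ac)
  finally show ?thesis
    by (simp add: theta_reflect_overpartitions theta_mult_reflect)
qed

section \<open>Dissections of theta\<close>

definition multisect :: "nat \<Rightarrow> int fps \<Rightarrow> int fps" where
  "multisect k F = Abs_fps (\<lambda>n. F $ (k * n))"

lemma multisect_nth [simp]: "multisect k F $ n = F $ (k * n)"
  by (simp add: multisect_def)

lemma multisect_add: "multisect k (F + G) = multisect k F + multisect k G"
  by (simp add: fps_eq_iff)

lemma multisect_multisect: "multisect k (multisect l F) = multisect (l * k) F"
  by (simp add: fps_eq_iff mult.assoc)

lemma multisect_numeral_mult: "multisect k (numeral w * F) = numeral w * multisect k F"
  by (simp add: fps_eq_iff numeral_fps_const)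

lemma multisect_dilate_mult:
  assumes "0 < k"
  shows "multisect k (dilate k F * G) = F * multisect k G"
proof (rule fps_ext)
  fix n
  have "(dilate k F * G) $ (k * n) = (\<Sum>i=0..k * n. dilate k F $ i * G $ (k * n - i))"
    by (simp add: fps_mult_nth)
  also have "\<dots> = (\<Sum>i\<in>(*) k ` {0..n}. dilate k F $ i * G $ (k * n - i))"
    using assms by (intro sum.mono_neutral_right) (auto simp: dilate_nth elim!: dvdE)
  also have "\<dots> = (\<Sum>j=0..n. F $ j * G $ (k * (n - j)))"
    using assms by (subst sum.reindex) (auto simp: inj_on_def dilate_nth right_diff_distrib')
  finally show "multisect k (dilate k F * G) $ n = (F * multisect k G) $ n"
    by (simp add: fps_mult_nth)
qed

lemma multisect_dilate: "0 < k \<Longrightarrow> multisect k (dilate k F) = F"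
  by (rule fps_ext) (simp add: dilate_nth)

lemma multisect_dilate_mult_X_power:
  assumes "0 < k" "\<not> k dvd j"
  shows "multisect k (dilate k F * fps_X ^ j) = 0"
proof -
  have "multisect k (fps_X ^ j) = 0"
    using assms by (auto simp: fps_eq_iff fps_X_power_nth)
  then show ?thesis
    using assms by (simp add: multisect_dilate_mult)
qed

lemma multisect_2_dilate_mult_X: "multisect 2 (dilate 2 F * fps_X) = 0"
  using multisect_dilate_mult_X_power[of 2 1 F] by simp

lemma dilate_dilate: "0 < k \<Longrightarrow> 0 < l \<Longrightarrow> dilate k (dilate l F) = dilate (k * l) F"
  by (simp add: fps_X_power_compose power_mult flip: fps_compose_assoc)

lemma reflect_dilate_even: "even k \<Longrightarrow> 0 < k \<Longrightarrow> reflect (dilate k F) = dilate k F"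
  by (rule fps_ext) (auto simp: reflect_nth dilate_nth elim!: dvdE)

lemma XD_dilate: "0 < k \<Longrightarrow> fps_XD (dilate k F) = of_nat k * dilate k (fps_XD F)"
  by (rule fps_ext) (auto simp: dilate_nth fps_of_nat[symmetric] elim!: dvdE)

text \<open>
  Squares are 0 or 1 modulo 4, and \<open>(2 i)\<^sup>2 = 4 i\<^sup>2\<close> makes the part with exponents divisible by 4 a copy of
  \<open>theta\<close> itself. This self-similarity is behind all congruences between the coefficients at
  \<open>n\<close> and at \<open>4 n\<close>.
\<close>
lemma theta_dissection:
  obtains psi where "theta = dilate 4 theta + 2 * (fps_X * dilate 4 psi)"
proof
  define psi where "psi = Abs_fps (\<lambda>n. if \<exists>j. 4 * n + 1 = j\<^sup>2 then 1 else 0 :: int)"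
  have sq: "j\<^sup>2 mod 4 = (if even j then 0 else 1)" for j :: nat
  proof (cases "even j")
    case True
    then show ?thesis by (auto elim!: evenE simp: power_mult_distrib)
  next
    case False
    then obtain b where "j = 2 * b + 1"
      by (rule oddE)
    then have "j\<^sup>2 = 1 + 4 * (b * b + b)"
      by (simp add: power2_eq_square algebra_simps)
    then have "j\<^sup>2 mod 4 = 1"
      by (simp only: mod_mult_self2) simp
    then show ?thesis using False by simp
  qed
  show "theta = dilate 4 theta + 2 * (fps_X * dilate 4 psi)"
  proof (rule fps_ext)
    fix n :: nat
    have "n mod 4 = 0 \<or> n mod 4 = 1 \<or> n mod 4 = 2 \<or> n mod 4 = 3"
      by linarith
    then consider k where "n = 4 * k" | k where "n = 4 * k + 1" | "n mod 4 = 2 \<or> n mod 4 = 3"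
      by (metis add.right_neutral mult_div_mod_eq)
    then show "theta $ n = (dilate 4 theta + 2 * (fps_X * dilate 4 psi)) $ n"
    proof cases
      case 1
      have "(\<exists>j. 4 * k = j\<^sup>2) \<longleftrightarrow> (\<exists>j. k = j\<^sup>2)"
      proof
        assume "\<exists>j. 4 * k = j\<^sup>2"
        then obtain j where j: "4 * k = j\<^sup>2" by auto
        then have "even j" using sq[of j] by (metis mod_mult_self1_is_0 zero_neq_one)
        then show "\<exists>j. k = j\<^sup>2" using j by (auto elim!: evenE simp: power_mult_distrib)
      next
        assume "\<exists>j. k = j\<^sup>2"
        then obtain j where "k = j\<^sup>2" by auto
        then show "\<exists>j. 4 * k = j\<^sup>2" by (intro exI[of _ "2 * j"]) (simp add: power_mult_distrib)
      qed
      moreover have "\<not> 4 dvd 4 * k - Suc 0" if "k \<noteq> 0"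
        using that by presburger
      ultimately show ?thesis
        by (auto simp: 1 theta_def dilate_nth numeral_fps_const)
    next
      case 2
      moreover from this have "\<not> 4 dvd n" "n \<noteq> 0"
        by presburger+
      ultimately show ?thesis
        by (simp add: theta_def psi_def dilate_nth numeral_fps_const)
    next
      case 3
      have "\<not> (\<exists>j. n = j\<^sup>2)"
      proof
        assume "\<exists>j. n = j\<^sup>2"
        then obtain j where "n = j\<^sup>2" ..
        then show False
          using 3 sq[of j] by (simp split: if_splits)
      qed
      moreover have "\<not> 4 dvd n" "\<not> 4 dvd n - Suc 0" "n \<noteq> 0"
        using 3 by presburger+
      ultimately show ?thesis
        by (auto simp: theta_def dilate_nth numeral_fps_const)
    qed
  qed
qed

lemma XD_numeral_mult: "fps_XD (numeral w * F) = numeral w * fps_XD (F :: int fps)"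
  by (simp add: fps_XD_def)

text \<open>
  Multiplying the dissection of \<open>theta\<close> with its reflection gives \<open>theta(-q\<^sup>2)\<^sup>2\<close> as a difference of
  two squares; replacing \<open>q\<^sup>2\<close> by \<open>-q\<close> changes the difference into a sum.
\<close>
lemma theta_squared_dissection:
  assumes "theta = dilate 4 theta + 2 * (fps_X * dilate 4 psi)"
  shows "theta\<^sup>2 = dilate 2 (theta\<^sup>2) + 4 * (fps_X * dilate 2 (psi\<^sup>2))"
proof -
  define B where "B = dilate 2 (theta\<^sup>2) - 4 * (fps_X * dilate 2 (psi\<^sup>2))"
  have "dilate 2 B = (dilate 4 theta)\<^sup>2 - 4 * (fps_X\<^sup>2 * (dilate 4 psi)\<^sup>2)"
    unfolding B_def fps_compose_sub_distrib by (simp add: dilate_mult dilate_dilate dilate_power)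
  also have "\<dots> = (dilate 4 theta + 2 * (fps_X * dilate 4 psi)) * (dilate 4 theta - 2 * (fps_X * dilate 4 psi))"
    by (simp add: algebra_simps power2_eq_square)
  also have "dilate 4 theta - 2 * (fps_X * dilate 4 psi) = reflect (dilate 4 theta + 2 * (fps_X * dilate 4 psi))"
    by (simp add: fps_compose_add_distrib reflect_mult reflect_dilate_even)
  also have "(dilate 4 theta + 2 * (fps_X * dilate 4 psi)) * \<dots> = theta * reflect theta"
    by (simp only: assms[symmetric])
  finally have "dilate 2 B = dilate 2 ((reflect theta)\<^sup>2)"
    by (simp only: theta_mult_reflect)
  then have "B = (reflect theta)\<^sup>2"
    using multisect_dilate[of 2] by (metis zero_less_numeral)
  then have "theta\<^sup>2 = reflect B"
    by (simp add: reflect_power reflect_reflect)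
  also have "\<dots> = dilate 2 (theta\<^sup>2) + 4 * (fps_X * dilate 2 (psi\<^sup>2))"
    unfolding B_def fps_compose_sub_distrib by (simp add: reflect_mult reflect_dilate_even)
  finally show ?thesis .
qed

text \<open>
  In terms of representations by two squares: \<open>2 n\<close> has as many as \<open>n\<close>.
\<close>
lemma multisect_theta_squared: "multisect 2 (theta\<^sup>2) = theta\<^sup>2"
proof -
  obtain psi where psi: "theta = dilate 4 theta + 2 * (fps_X * dilate 4 psi)"
    by (rule theta_dissection)
  define F where "F = theta\<^sup>2"
  define G where "G = dilate 2 (theta * psi)"
  have "F = (dilate 4 theta)\<^sup>2 + 4 * (fps_X\<^sup>2 * (dilate 4 psi)\<^sup>2)
      + 4 * ((dilate 4 theta * dilate 4 psi) * fps_X)"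
    unfolding F_def by (subst psi) (simp add: algebra_simps power2_eq_square)
  also have "(dilate 4 theta)\<^sup>2 + 4 * (fps_X\<^sup>2 * (dilate 4 psi)\<^sup>2) = dilate 2 F"
    unfolding F_def by (subst theta_squared_dissection[OF psi])
      (simp add: fps_compose_add_distrib dilate_mult dilate_dilate dilate_power)
  also have "dilate 4 theta * dilate 4 psi = dilate 2 G"
    by (simp add: G_def dilate_mult dilate_dilate)
  finally have "multisect 2 F = multisect 2 (dilate 2 F + 4 * (dilate 2 G * fps_X))"
    by (rule arg_cong)
  also have "\<dots> = F"
    by (simp add: multisect_add multisect_numeral_mult multisect_2_dilate_mult_X multisect_dilate)
  finally show ?thesis
    by (simp add: F_def)
qed

lemma multisect_XD_theta: "multisect 2 (fps_XD theta) = dilate 2 (4 * fps_XD theta)"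
proof -
  obtain psi where psi: "theta = dilate 4 theta + 2 * (fps_X * dilate 4 psi)"
    by (rule theta_dissection)
  define F where "F = dilate 2 (psi + 4 * fps_XD psi)"
  have "fps_XD theta = fps_XD (dilate 4 theta) + 2 * fps_XD (fps_X * dilate 4 psi)"
    by (subst psi) (simp add: XD_numeral_mult)
  also have "fps_XD (dilate 4 theta) = dilate 2 (dilate 2 (4 * fps_XD theta))"
    by (simp add: XD_dilate dilate_dilate dilate_mult)
  also have "fps_XD (fps_X * dilate 4 psi) = dilate 2 F * fps_X"
    by (simp add: fps_XD_mult XD_dilate F_def dilate_dilate fps_compose_add_distrib dilate_mult)
       (simp add: fps_XD_def algebra_simps)
  finally have "multisect 2 (fps_XD theta) =
      multisect 2 (dilate 2 (dilate 2 (4 * fps_XD theta)) + 2 * (dilate 2 F * fps_X))"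
    by (rule arg_cong)
  then show ?thesis
    by (simp only: multisect_add multisect_numeral_mult multisect_2_dilate_mult_X multisect_dilate) simp
qed

text \<open>
  The denominator \<open>theta(-q\<^sup>2)\<^sup>2\<close> is a series in \<open>q\<^sup>2\<close>, so keeping only the even exponents
  and halving them affects the numerator alone. The denominator becomes \<open>theta(-q)\<^sup>2\<close>, and multiplication by
  the same power of \<open>theta(q)\<close> makes it a series in \<open>q\<^sup>2\<close> again, namely \<open>theta(-q\<^sup>2)^4\<close>. A second
  round leads to \<open>4 theta^6 D theta / theta(-q\<^sup>2)^8\<close>; the factor 7 makes the numerator a derivative.
\<close>
lemma multisect_SOME_gf:
  "7 * (multisect 4 SOME_gf * dilate 2 (reflect theta ^ 8)) = 4 * fps_XD (theta ^ 7)"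
proof -
  define w where "w = reflect theta"
  define D where "D = fps_XD theta"
  have tw: "theta\<^sup>2 * w\<^sup>2 = dilate 2 (w ^ 4)"
    using arg_cong[OF theta_mult_reflect, of "\<lambda>F. F\<^sup>2"]
    by (simp add: w_def power_mult_distrib flip: dilate_power)
  have tw2: "theta ^ 4 * w ^ 4 = dilate 2 (w ^ 8)"
    using arg_cong[OF tw, of "\<lambda>F. F\<^sup>2"]
    by (simp add: w_def power_mult_distrib flip: dilate_power)
  have "multisect 2 (dilate 2 (w\<^sup>2) * SOME_gf) = multisect 2 D"
    using SOME_gf_theta by (simp add: w_def D_def mult.commute)
  then have "w\<^sup>2 * multisect 2 SOME_gf = dilate 2 (4 * D)"
    by (simp add: multisect_dilate_mult D_def multisect_XD_theta)
  then have "theta\<^sup>2 * w\<^sup>2 * multisect 2 SOME_gf = dilate 2 (4 * D) * theta\<^sup>2"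
    by (simp add: mult_ac)
  then have "multisect 2 (dilate 2 (w ^ 4) * multisect 2 SOME_gf) = multisect 2 (dilate 2 (4 * D) * theta\<^sup>2)"
    by (simp only: tw)
  then have "w ^ 4 * multisect 4 SOME_gf = 4 * D * theta\<^sup>2"
    by (simp add: multisect_dilate_mult multisect_multisect multisect_theta_squared)
  then have "theta ^ 4 * w ^ 4 * multisect 4 SOME_gf = theta ^ 4 * (4 * D * theta\<^sup>2)"
    by (simp only: mult.assoc)
  then have "multisect 4 SOME_gf * dilate 2 (w ^ 8) = 4 * D * theta ^ 6"
    unfolding tw2 by (simp add: mult_ac flip: power_add)
  moreover have "fps_XD (theta ^ 7) = 7 * theta ^ 6 * D"
    using fps_XD_power[of theta 6] by (simp add: D_def)
  ultimately show ?thesis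
    by (simp add: w_def mult_ac)
qed

section \<open>Congruences\<close>

lemma numeral_dvd_fps_iff: "(numeral w :: int fps) dvd F \<longleftrightarrow> (\<forall>n. numeral w dvd F $ n)"
proof
  assume "\<forall>n. numeral w dvd F $ n"
  then have "F = numeral w * Abs_fps (\<lambda>n. F $ n div numeral w)"
    by (simp add: fps_eq_iff numeral_fps_const)
  then show "numeral w dvd F"
    by (metis dvd_triv_left)
qed (auto simp: numeral_fps_const elim!: dvdE)

text \<open>
  Expand \<open>(V + 2 q p)^7\<close>, where \<open>V\<close> and \<open>p\<close> are series in \<open>q^4\<close>: the terms with \<open>q\<close>, \<open>q\<^sup>2\<close> and
  \<open>q\<^sup>3\<close> do not meet the exponents divisible by 4, and all later terms are divisible by \<open>2^4\<close>.
\<close>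
lemma theta_odd_power: "16 dvd multisect 4 (theta ^ 7) - theta ^ 7"
proof -
  obtain psi where psi: "theta = dilate 4 theta + 2 * (fps_X * dilate 4 psi)"
    by (rule theta_dissection)
  define V where "V = dilate 4 theta"
  define p where "p = dilate 4 psi"
  define R where "R = 35 * fps_X ^ 4 * V ^ 3 * p ^ 4 + 42 * fps_X ^ 5 * V\<^sup>2 * p ^ 5
     + 28 * fps_X ^ 6 * V * p ^ 6 + 8 * fps_X ^ 7 * p ^ 7"
  have expand: "(a + 2 * b) ^ 7 = a ^ 7 + 14 * (a ^ 6 * b) + 84 * (a ^ 5 * b\<^sup>2) + 280 * (a ^ 4 * b ^ 3)
     + 16 * (35 * a ^ 3 * b ^ 4 + 42 * a\<^sup>2 * b ^ 5 + 28 * a * b ^ 6 + 8 * b ^ 7)" for a b :: "int fps"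
    by algebra
  have V: "V ^ 7 = dilate 4 (theta ^ 7)" "V ^ 6 * p = dilate 4 (theta ^ 6 * psi)"
    "V ^ 5 * p\<^sup>2 = dilate 4 (theta ^ 5 * psi\<^sup>2)" "V ^ 4 * p ^ 3 = dilate 4 (theta ^ 4 * psi ^ 3)"
    by (simp_all add: V_def p_def dilate_mult dilate_power)
  have "theta ^ 7 = (V + 2 * (fps_X * p)) ^ 7"
    using psi by (simp only: V_def p_def)
  also have "\<dots> = V ^ 7 + 14 * ((V ^ 6 * p) * fps_X ^ 1) + 84 * ((V ^ 5 * p\<^sup>2) * fps_X\<^sup>2)
     + 280 * ((V ^ 4 * p ^ 3) * fps_X ^ 3) + 16 * R"
    unfolding expand by (simp add: R_def power_mult_distrib mult_ac)
  finally have "multisect 4 (theta ^ 7) = multisect 4 (dilate 4 (theta ^ 7)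
     + 14 * (dilate 4 (theta ^ 6 * psi) * fps_X ^ 1)
     + 84 * (dilate 4 (theta ^ 5 * psi\<^sup>2) * fps_X\<^sup>2)
     + 280 * (dilate 4 (theta ^ 4 * psi ^ 3) * fps_X ^ 3) + 16 * R)"
    unfolding V by (rule arg_cong)
  also have "\<dots> = theta ^ 7 + 16 * multisect 4 R"
    by (simp add: multisect_add multisect_numeral_mult multisect_dilate multisect_dilate_mult_X_power
          multisect_dilate_mult_X_power[of 4 1, simplified])
  finally show ?thesis
    by simp
qed

lemma theta_mod_2: obtains x where "theta = 1 + 2 * x"
proof
  show "theta = 1 + 2 * Abs_fps (\<lambda>n. if n \<noteq> 0 \<and> (\<exists>j. n = j\<^sup>2) then 1 else 0)"
    by (auto simp: fps_eq_iff theta_def numeral_fps_const)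
qed

lemma power_8_mod_16:
  fixes y :: "'a :: comm_ring_1"
  obtains h where "(1 + 2 * y) ^ 8 = 1 + 16 * h"
proof
  define u where "u = y + y\<^sup>2"
  define v where "v = u + 2 * u\<^sup>2"
  have "(1 + 2 * y)\<^sup>2 = 1 + 4 * u"
    by (simp add: u_def power2_eq_square algebra_simps)
  moreover have "(1 + 4 * u)\<^sup>2 = 1 + 8 * v"
    by (simp add: v_def power2_eq_square algebra_simps)
  moreover have "(1 + 8 * v)\<^sup>2 = 1 + 16 * (v + 4 * v\<^sup>2)"
    by (simp add: power2_eq_square algebra_simps)
  moreover have "(1 + 2 * y) ^ 8 = (((1 + 2 * y)\<^sup>2)\<^sup>2)\<^sup>2"
    by (simp flip: power_mult)
  ultimately show "(1 + 2 * y) ^ 8 = 1 + 16 * (v + 4 * v\<^sup>2)"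
    by simp
qed

text \<open>
  Modulo 256, \<open>1 - 16 h\<close> is an inverse of \<open>1 + 16 h\<close>.
\<close>
lemma dvd_cancel_unit_mod_16:
  fixes F :: "'a :: comm_ring_1"
  assumes "m dvd 256" "m dvd F * (1 + 16 * h)"
  shows "m dvd F"
proof -
  have "F = F * (1 + 16 * h) * (1 - 16 * h) + 256 * (h\<^sup>2 * F)"
    by (simp add: power2_eq_square algebra_simps)
  then show ?thesis
    using assms by (metis dvd_add dvd_mult2)
qed

text \<open>
  The eighth power in the denominator is 1 modulo 16, because \<open>theta\<close> is 1 modulo 2.
\<close>
lemma multisect_SOME_gf_unit:
  obtains h where "7 * multisect 4 SOME_gf * (1 + 16 * dilate 2 h) = 4 * fps_XD (theta ^ 7)"
proof -
  obtain x where x: "theta = 1 + 2 * x"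
    by (rule theta_mod_2)
  obtain h where h: "(1 + 2 * reflect x) ^ 8 = 1 + 16 * h"
    by (rule power_8_mod_16)
  have "reflect theta ^ 8 = 1 + 16 * h"
    unfolding h[symmetric] x by (simp add: fps_compose_add_distrib reflect_mult)
  then have "dilate 2 (reflect theta ^ 8) = 1 + 16 * dilate 2 h"
    by (simp add: fps_compose_add_distrib dilate_mult)
  then show ?thesis
    using multisect_SOME_gf that by (simp add: mult.assoc)
qed

text \<open>
  \<open>theta^6\<close> is 1 modulo 4 and \<open>D theta\<close> is even, so modulo 8 only \<open>7 D theta\<close> matters. An even square is
  divisible by 4, which gives another factor 4 at the even exponents.
\<close>
lemma multisect_XD_theta_power: "8 dvd multisect 2 (fps_XD (theta ^ 7))"
proof -
  obtain x where x: "theta = 1 + 2 * x"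
    by (rule theta_mod_2)
  define T where "T = fps_XD x"
  define u where "u = x + x\<^sup>2"
  have T: "fps_XD theta = 2 * T"
    by (simp add: x T_def XD_numeral_mult) (simp add: fps_XD_def)
  have "theta\<^sup>2 = 1 + 4 * u"
    by (simp add: x u_def power2_eq_square algebra_simps)
  then have "(theta\<^sup>2) ^ 3 = (1 + 4 * u) ^ 3"
    by (rule arg_cong)
  then have "theta ^ 6 = (1 + 4 * u) ^ 3"
    by (simp only: power_mult[symmetric]) simp
  also have "\<dots> = 1 + 4 * (3 * u + 12 * u\<^sup>2 + 16 * u ^ 3)"
    by (simp add: power2_eq_square power3_eq_cube algebra_simps)
  finally obtain k where k: "theta ^ 6 = 1 + 4 * k"
    by blast
  have "fps_XD (theta ^ 7) = 7 * (theta ^ 6 * fps_XD theta)"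
    using fps_XD_power[of theta 6] by simp
  also have "theta ^ 6 * fps_XD theta = fps_XD theta + 8 * (k * T)"
    unfolding k T by (simp add: algebra_simps)
  finally have "multisect 2 (fps_XD (theta ^ 7)) = 7 * (dilate 2 (4 * fps_XD theta) + 8 * multisect 2 (k * T))"
    by (simp only: multisect_add multisect_numeral_mult multisect_XD_theta)
  also have "dilate 2 (4 * fps_XD theta) = 8 * dilate 2 T"
    by (simp add: T dilate_mult)
  finally have "multisect 2 (fps_XD (theta ^ 7)) = 8 * (7 * (dilate 2 T + multisect 2 (k * T)))"
    by (simp add: algebra_simps)
  then show ?thesis
    by (metis dvd_triv_left)
qed

text \<open>
  The right-hand side \<open>4 D(theta^7)\<close> of \<open>multisect_SOME_gf_unit\<close> is divisible by 8, hence so is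
  \<open>7 multisect 4 SOME_gf\<close>; dropping the unit \<open>1 + 16 dilate 2 h\<close> therefore changes the left-hand side
  by a multiple of \<open>16 \<cdot> 8 = 128\<close> only.
\<close>
lemma SOME_over_mod_128: "[7 * SOME_over (4 * n) = 4 * int n * theta ^ 7 $ n] (mod 128)"
proof -
  let ?s = "multisect 4 SOME_gf" and ?A = "fps_XD (theta ^ 7)"
  obtain h where h: "7 * ?s * (1 + 16 * dilate 2 h) = 4 * ?A"
    by (rule multisect_SOME_gf_unit)
  obtain x where x: "theta = 1 + 2 * x"
    by (rule theta_mod_2)
  have "?A = 7 * (theta ^ 6 * fps_XD theta)"
    using fps_XD_power[of theta 6] by simp
  also have "fps_XD theta = 2 * fps_XD x"
    by (simp add: x XD_numeral_mult) (simp add: fps_XD_def)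
  finally have "4 * ?A = 8 * (7 * (theta ^ 6 * fps_XD x))"
    by simp
  then have "8 dvd 7 * ?s * (1 + 16 * dilate 2 h)"
    unfolding h by (metis dvd_triv_left)
  then have "8 dvd 7 * ?s"
    by (rule dvd_cancel_unit_mod_16[rotated]) (auto intro: dvdI[of _ _ 32])
  then obtain r where r: "7 * ?s = 8 * r" ..
  have "4 * ?A - 7 * ?s = 16 * (7 * ?s) * dilate 2 h"
    unfolding h[symmetric] by (simp add: algebra_simps)
  also have "\<dots> = 128 * (r * dilate 2 h)"
    unfolding r by simp
  finally have "128 dvd 4 * ?A - 7 * ?s"
    by simp
  then have "128 dvd (4 * ?A - 7 * ?s) $ n"
    by (simp only: numeral_dvd_fps_iff)
  then show ?thesis
    by (simp add: cong_iff_dvd_diff dvd_diff_commute SOME_gf_def numeral_fps_const mult.assoc)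
qed

text \<open>
  The same argument at the even exponents, where the series are divisible by 32 in place of 8,
  and \<open>16 \<cdot> 32 = 512\<close>.
\<close>
lemma SOME_over_mod_512: "[7 * SOME_over (8 * n) = 8 * int n * theta ^ 7 $ (2 * n)] (mod 512)"
proof -
  let ?s = "multisect 4 SOME_gf" and ?A = "fps_XD (theta ^ 7)"
  obtain h where h: "7 * ?s * (1 + 16 * dilate 2 h) = 4 * ?A"
    by (rule multisect_SOME_gf_unit)
  define t where "t = 7 * multisect 2 ?s"
  have "4 * ?A = 7 * (dilate 2 (1 + 16 * h) * ?s)"
    unfolding h[symmetric] by (simp add: fps_compose_add_distrib dilate_mult)
  then have "multisect 2 (4 * ?A) = multisect 2 (7 * (dilate 2 (1 + 16 * h) * ?s))"
    by (simp only:)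
  then have A: "4 * multisect 2 ?A = t * (1 + 16 * h)"
    unfolding multisect_numeral_mult by (simp add: multisect_dilate_mult t_def)
  obtain a where "multisect 2 ?A = 8 * a"
    using multisect_XD_theta_power ..
  then have "t * (1 + 16 * h) = 32 * a"
    using A by simp
  then have "32 dvd t * (1 + 16 * h)"
    by simp
  then have "32 dvd t"
    by (rule dvd_cancel_unit_mod_16[rotated]) (auto intro: dvdI[of _ _ 8])
  then obtain r where r: "t = 32 * r" ..
  have "4 * multisect 2 ?A - t = 512 * (r * h)"
    unfolding A by (simp add: r algebra_simps)
  then have "512 dvd 4 * multisect 2 ?A - t"
    by simp
  then have "512 dvd (4 * multisect 2 ?A - t) $ n"
    by (simp only: numeral_dvd_fps_iff)
  then show ?thesis
    by (simp add: cong_iff_dvd_diff dvd_diff_commute SOME_gf_def t_def numeral_fps_const mult.assoc)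
qed

lemma theta_power_mod_16: "[theta ^ 7 $ (4 * n) = theta ^ 7 $ n] (mod 16)"
  using theta_odd_power by (simp add: numeral_dvd_fps_iff cong_iff_dvd_diff)

theorem theorem10:
  fixes n :: nat
  shows "[SOME_over (16 * n) = 2 ^ 2 * SOME_over (4 * n)] (mod 2 ^ 7) \<and>
         [SOME_over (32 * n) = 2 ^ 2 * SOME_over (8 * n)] (mod 2 ^ 9)"
proof
  \<comment> \<open>439 inverts 7 modulo 512.\<close>
  have cancel_7: "m dvd x" if "m dvd 7 * x" "m dvd 512" for m x :: int
  proof -
    have "x = 439 * (7 * x) - 512 * (6 * x)"
      by simp
    then show ?thesis
      using that by (metis dvd_diff dvd_mult dvd_mult2)
  qed
  define c where "c k = theta ^ 7 $ k" for k
  have c: "16 dvd c (4 * k) - c k" for k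
    using theta_power_mod_16[of k] by (simp add: c_def cong_iff_dvd_diff)
  obtain a where a: "c (4 * n) - c n = 16 * a"
    using c ..
  have "[7 * SOME_over (4 * (4 * n)) - 4 * (7 * SOME_over (4 * n)) =
      4 * int (4 * n) * c (4 * n) - 4 * (4 * int n * c n)] (mod 128)"
    unfolding c_def by (intro cong_diff cong_mult cong_refl SOME_over_mod_128)
  also have "4 * int (4 * n) * c (4 * n) - 4 * (4 * int n * c n) = 128 * (2 * int n * a)"
    using a by (simp add: algebra_simps)
  also have "[128 * (2 * int n * a) = 0] (mod 128)"
    by (simp add: cong_0_iff)
  finally have "128 dvd 7 * (SOME_over (16 * n) - 4 * SOME_over (4 * n))"
    by (simp add: cong_0_iff algebra_simps)
  then have "128 dvd SOME_over (16 * n) - 4 * SOME_over (4 * n)"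
    by (rule cancel_7) simp
  then show "[SOME_over (16 * n) = 2 ^ 2 * SOME_over (4 * n)] (mod 2 ^ 7)"
    by (simp add: cong_iff_dvd_diff)
  obtain b where b: "c (4 * (2 * n)) - c (2 * n) = 16 * b"
    using c ..
  have "[7 * SOME_over (8 * (4 * n)) - 4 * (7 * SOME_over (8 * n)) =
      8 * int (4 * n) * c (2 * (4 * n)) - 4 * (8 * int n * c (2 * n))] (mod 512)"
    unfolding c_def by (intro cong_diff cong_mult cong_refl SOME_over_mod_512)
  also have "8 * int (4 * n) * c (2 * (4 * n)) - 4 * (8 * int n * c (2 * n)) = 512 * (int n * b)"
    using b by (simp add: algebra_simps)
  also have "[512 * (int n * b) = 0] (mod 512)"
    by (simp add: cong_0_iff)
  finally have "512 dvd 7 * (SOME_over (32 * n) - 4 * SOME_over (8 * n))"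
    by (simp add: cong_0_iff algebra_simps)
  then have "512 dvd SOME_over (32 * n) - 4 * SOME_over (8 * n)"
    by (rule cancel_7) simp
  then show "[SOME_over (32 * n) = 2 ^ 2 * SOME_over (8 * n)] (mod 2 ^ 9)"
    by (simp add: cong_iff_dvd_diff)
qed

end
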